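(* Let $k$ be an algebraically closed field of characteristic $0$, let $G=(C_2)^2=\langle g_1,g_2\rangle$ be the Klein four-group, and let $\mu$ be the normalised 2-cocycle $\mu(g_1^pg_2^q,g_1^rg_2^s)=(-1)^{ps}$ for $p,q,r,s\in\{0,1\}$. With the action of $G$ described in the context, one has the following isomorphisms of $k$-algebras: $$\mathcal{A}(1,-1)^{G,\mu}\cong\mathcal{D}(1,1),\quad \mathcal{B}(1)^{G,\mu}\cong\mathcal{C}(1),\quad \mathcal{E}(1,\gamma)^{G,\mu}\cong\mathcal{E}(1,-\gamma),\quad \mathcal{G}(1,\gamma)^{G,\mu}\cong\mathcal{G}(1,\overline{\gamma}).$$ Here $\gamma=\pm i$ for the family $\mathcal{E}$, and $\gamma=\frac{1+i}{2}$, $\overline\gamma=\frac{1}{2\gamma}=\frac{1-i}{2}$ for the family $\mathcal{G}$, with $i^2=-1$.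
   Context: These algebras belong to Rogalski and Zhang's classification of AS-regular algebras of dimension 4 with three degree-1 generators $x_1,x_2,x_3$ and a proper $\mathbb{Z}^2$-grading ($x_1,x_2$ in bidegree $(1,0)$, $x_3$ in bidegree $(0,1)$). Write $w_1=x_1+x_2$, $w_2=x_1-x_2$, $w_3=x_3$, $[x,y]=xy-yx$ and $[x,y]_+=xy+yx$. In terms of the generators $w_1,w_2,w_3$ the algebras are presented as follows. - $\mathcal{A}(1,-1),\mathcal{B}(1),\mathcal{C}(1),\mathcal{D}(1,1)$ each have the three relations $w_1^2-w_2^2$, $w_3w_1-w_1w_3$, $w_3^2w_2-w_2w_3^2$, together with one further relation: $[w_3,[w_1,w_2]_+]$ for $\mathcal{A}(1,-1)$; $[w_3,[w_2,w_1]]_+$ for $\mathcal{B}(1)$; $[w_3,[w_1,w_2]]$ for $\mathcal{C}(1)$; $[w_3,[w_1,w_2]_+]_+$ for $\mathcal{D}(1,1)$. - $\mathcal{E}(1,\gamma)$ ($\gamma=\pm i$) has relations $w_1^2-w_2^2$, $w_3w_1-w_1w_3$, $w_3^2w_2+w_2w_3^2$ and $w_3w_2w_1-w_1w_3w_2+\gamma w_1w_2w_3-\gamma w_2w_1w_3$. - $\mathcal{G}(1,\gamma)$ has relations $w_1^2-w_2^2$, $w_3w_1-w_1w_3$, $w_3^2w_2+w_2w_3^2$ and $w_3w_1w_2+w_3w_2w_1+cw_1w_2w_3+cw_2w_1w_3$, with $c=i$ for $\gamma=\frac{1+i}{2}$ and $c=-i$ for $\gamma=\frac{1-i}{2}$.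 Action: $g_1$ interchanges $x_1$ and $x_2$ and fixes $x_3$; $g_2$ fixes $x_1,x_2$ and sends $x_3\mapsto-x_3$. Identify $G$ with its character group by letting $\chi_{g_1}$ be the character with $\chi_{g_1}(g_1)=1$, $\chi_{g_1}(g_2)=-1$, and $\chi_{g_2}$ the one with $\chi_{g_2}(g_1)=-1$, $\chi_{g_2}(g_2)=1$. For an algebra $A$ on which $G$ acts, $A_g=\{a:a^h=\chi_{g^{-1}}(h)a\ \forall h\in G\}$ is a $G$-grading (here $w_1\in A_e$, $w_2\in A_{g_2}$, $w_3\in A_{g_1}$), and the cocycle twist $A^{G,\mu}$ is $A$ with the multiplication $a\ast_\mu b=\mu(g,h)ab$ for $a\in A_g$, $b\in A_h$. *)

theory Defs
  imports
    "HOL-Library.Poly_Mapping"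
    "HOL-Computational_Algebra.Polynomial"
    "HOL-Algebra.QuotRing"
    "HOL-Algebra.Module"
    "HOL-Algebra.Elementary_Groups"
begin

section \<open>Free algebras and presentations\<close>

text \<open>
  Words are lists wrapped in a type of their own, so that the monoid structure given by
  concatenation turns \<open>'x word \<Rightarrow>\<^sub>0 'k\<close> into the free associative unital algebra.
\<close>

datatype 'x word = Word (letters: "'x list")

instantiation word :: (type) monoid_add
begin

definition "0 = Word []"
definition "u + v = Word (letters u @ letters v)"

instance by standard (simp_all add: zero_word_def plus_word_def)

end

abbreviation scale :: "'k::semiring_0 \<Rightarrow> ('a \<Rightarrow>\<^sub>0 'k) \<Rightarrow> ('a \<Rightarrow>\<^sub>0 'k)"
  where "scale c \<equiv> Poly_Mapping.map ((*) c)"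

definition free_algebra :: "('k::field, 'x word \<Rightarrow>\<^sub>0 'k) module"
  where "free_algebra =
    \<lparr>carrier = UNIV, monoid.mult = (*), one = 1, zero = 0, add = (+), smult = scale\<rparr>"

definition gen :: "'x \<Rightarrow> ('x word \<Rightarrow>\<^sub>0 'k::field)"
  where "gen x = Poly_Mapping.single (Word [x]) 1"

text \<open>The algebra endomorphism of the free algebra with \<open>x \<mapsto> f x\<close> on generators.\<close>

definition subst :: "('x \<Rightarrow> ('x word \<Rightarrow>\<^sub>0 'k::field)) \<Rightarrow> ('x word \<Rightarrow>\<^sub>0 'k) \<Rightarrow> ('x word \<Rightarrow>\<^sub>0 'k)"
  where "subst f p =
    (\<Sum>w\<in>Poly_Mapping.keys p. scale (Poly_Mapping.lookup p w) (prod_list (map f (letters w))))"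

text \<open>The scalar multiplication mirrors \<^const>\<open>rcoset_mult\<close>.\<close>

definition quot_algebra :: "('k, 'a) module \<Rightarrow> 'a set \<Rightarrow> ('k, 'a set) module"
  where "quot_algebra A I = ring.extend (A Quot I)
    (module.fields (\<lambda>c X. \<Union>x\<in>X. I +>\<^bsub>A\<^esub> (c \<odot>\<^bsub>A\<^esub> x)))"

text \<open>
  \<^const>\<open>genideal\<close> is the two-sided ideal generated by a set; it is closed under scalars, since
  these embed in the free algebra.
\<close>

definition presented :: "('x word \<Rightarrow>\<^sub>0 'k::field) set \<Rightarrow> ('k, ('x word \<Rightarrow>\<^sub>0 'k) set) module"
  where "presented R = quot_algebra free_algebra (Idl\<^bsub>free_algebra\<^esub> R)"

definition algebra_isomorphic :: "('k, 'a) module \<Rightarrow> ('k, 'b) module \<Rightarrow> bool"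
    (infix \<open>\<cong>\<^sub>a\<^sub>l\<^sub>g\<close> 50)
  where "A \<cong>\<^sub>a\<^sub>l\<^sub>g B \<longleftrightarrow>
    (\<exists>f \<in> ring_iso A B. \<forall>c. \<forall>a \<in> carrier A. f (c \<odot>\<^bsub>A\<^esub> a) = c \<odot>\<^bsub>B\<^esub> f a)"


section \<open>Gradings from group actions and cocycle twists\<close>

text \<open>
  \<open>act h a\<close> is \<open>a\<^sup>h\<close>, and \<open>\<chi> g\<close> is the character with which \<open>g\<close> is identified.
\<close>

definition graded_part ::
    "('g, 'm) monoid_scheme \<Rightarrow> ('g \<Rightarrow> 'g \<Rightarrow> 'k) \<Rightarrow> ('g \<Rightarrow> 'a \<Rightarrow> 'a) \<Rightarrow> ('k, 'a) module \<Rightarrow> 'g \<Rightarrow> 'a set"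
  where "graded_part G \<chi> act A g =
    {a \<in> carrier A. \<forall>h \<in> carrier G. act h a = \<chi> (inv\<^bsub>G\<^esub> g) h \<odot>\<^bsub>A\<^esub> a}"

text \<open>The unique decomposition of \<open>a\<close> into homogeneous components.\<close>

definition components ::
    "('g, 'm) monoid_scheme \<Rightarrow> ('g \<Rightarrow> 'g \<Rightarrow> 'k) \<Rightarrow> ('g \<Rightarrow> 'a \<Rightarrow> 'a) \<Rightarrow> ('k, 'a) module \<Rightarrow> 'a \<Rightarrow> 'g \<Rightarrow> 'a"
  where "components G \<chi> act A a =
    (THE f. f \<in> (\<Pi>\<^sub>E g \<in> carrier G. graded_part G \<chi> act A g) \<and> a = finsum A f (carrier G))"

text \<open>
  The twisted product is the biadditive extension of \<open>a * b = \<mu> g h \<odot> (a \<otimes> b)\<close> for homogeneous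
  \<open>a\<close>, \<open>b\<close> of degrees \<open>g\<close>, \<open>h\<close>. The identity is unchanged because \<open>\<mu>\<close> is meant to be normalised.
\<close>

definition cocycle_twist ::
    "('g, 'm) monoid_scheme \<Rightarrow> ('g \<Rightarrow> 'g \<Rightarrow> 'k) \<Rightarrow> ('g \<Rightarrow> 'g \<Rightarrow> 'k) \<Rightarrow> ('g \<Rightarrow> 'a \<Rightarrow> 'a)
      \<Rightarrow> ('k, 'a) module \<Rightarrow> ('k, 'a) module"
  where "cocycle_twist G \<mu> \<chi> act A = A\<lparr>monoid.mult := (\<lambda>a b.
    finsum A (\<lambda>g. finsum A (\<lambda>h.
      \<mu> g h \<odot>\<^bsub>A\<^esub> (components G \<chi> act A a g \<otimes>\<^bsub>A\<^esub> components G \<chi> act A b h))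
      (carrier G)) (carrier G))\<rparr>"


section \<open>The Klein four-group, its action and its cocycle\<close>

text \<open>The pair \<open>(p, q)\<close> with \<open>p, q \<in> {0, 1}\<close> stands for \<open>g\<^sub>1\<^sup>p g\<^sub>2\<^sup>q\<close>.\<close>

definition klein_four :: "(int \<times> int) monoid"
  where "klein_four = integer_mod_group 2 \<times>\<times> integer_mod_group 2"

fun klein_cocycle :: "int \<times> int \<Rightarrow> int \<times> int \<Rightarrow> 'k::field"
  where "klein_cocycle (p, q) (r, s) = (- 1) ^ nat (p * s)"

text \<open>
  The identification with the character group: \<open>g\<^sub>1\<^sup>p g\<^sub>2\<^sup>q\<close> goes to \<open>\<chi>\<^sub>1\<^sup>p \<chi>\<^sub>2\<^sup>q\<close>, where \<open>\<chi>\<^sub>1\<close> is the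
  sign of the exponent of \<open>g\<^sub>2\<close> and \<open>\<chi>\<^sub>2\<close> the sign of the exponent of \<open>g\<^sub>1\<close>.
\<close>

fun klein_char :: "int \<times> int \<Rightarrow> int \<times> int \<Rightarrow> 'k::field"
  where "klein_char (p, q) (r, s) = ((- 1) ^ nat s) ^ nat p * ((- 1) ^ nat r) ^ nat q"

datatype var = X1 | X2 | X3

type_synonym 'k free3 = "var word \<Rightarrow>\<^sub>0 'k"

fun g1_on_gens :: "var \<Rightarrow> 'k::field free3"
  where
    "g1_on_gens X1 = gen X2"
  | "g1_on_gens X2 = gen X1"
  | "g1_on_gens X3 = gen X3"

fun g2_on_gens :: "var \<Rightarrow> 'k::field free3"
  where
    "g2_on_gens X1 = gen X1"
  | "g2_on_gens X2 = gen X2"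
  | "g2_on_gens X3 = - gen X3"

fun klein_act :: "int \<times> int \<Rightarrow> 'k::field free3 \<Rightarrow> 'k free3"
  where "klein_act (p, q) = (subst g1_on_gens ^^ nat p) \<circ> (subst g2_on_gens ^^ nat q)"

text \<open>
  An automorphism of the free algebra preserving the ideal of relations acts on the quotient by
  taking images of cosets.
\<close>

definition klein_twist :: "('k::field, 'k free3 set) module \<Rightarrow> ('k, 'k free3 set) module"
  where "klein_twist = cocycle_twist klein_four klein_cocycle klein_char (\<lambda>g X. klein_act g ` X)"


section \<open>The algebras\<close>

definition w1 :: "'k::field free3" where "w1 = gen X1 + gen X2"
definition w2 :: "'k::field free3" where "w2 = gen X1 - gen X2"
definition w3 :: "'k::field free3" where "w3 = gen X3"

definition comm :: "'a::ring \<Rightarrow> 'a \<Rightarrow> 'a" where "comm x y = x * y - y * x"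
definition acomm :: "'a::ring \<Rightarrow> 'a \<Rightarrow> 'a" where "acomm x y = x * y + y * x"

text \<open>
  With the parameters that are fixed here these are \<open>\<A>(1,-1)\<close>, \<open>\<B>(1)\<close>, \<open>\<C>(1)\<close>, \<open>\<D>(1,1)\<close>,
  \<open>\<E>(1,\<gamma>)\<close> and \<open>\<G>(1,\<gamma>)\<close>.
\<close>

definition alg_A :: "('k::field, 'k free3 set) module"
  where "alg_A = presented
    {w1^2 - w2^2, w3 * w1 - w1 * w3, w3^2 * w2 - w2 * w3^2, comm w3 (acomm w1 w2)}"

definition alg_B :: "('k::field, 'k free3 set) module"
  where "alg_B = presented
    {w1^2 - w2^2, w3 * w1 - w1 * w3, w3^2 * w2 - w2 * w3^2, acomm w3 (comm w2 w1)}"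

definition alg_C :: "('k::field, 'k free3 set) module"
  where "alg_C = presented
    {w1^2 - w2^2, w3 * w1 - w1 * w3, w3^2 * w2 - w2 * w3^2, comm w3 (comm w1 w2)}"

definition alg_D :: "('k::field, 'k free3 set) module"
  where "alg_D = presented
    {w1^2 - w2^2, w3 * w1 - w1 * w3, w3^2 * w2 - w2 * w3^2, acomm w3 (acomm w1 w2)}"

definition alg_E :: "'k::field \<Rightarrow> ('k, 'k free3 set) module"
  where "alg_E \<gamma> = presented
    {w1^2 - w2^2, w3 * w1 - w1 * w3, w3^2 * w2 + w2 * w3^2,
     w3 * w2 * w1 - w1 * w3 * w2 + scale \<gamma> (w1 * w2 * w3) - scale \<gamma> (w2 * w1 * w3)}"

text \<open>
  Here \<open>\<iota>\<close> is the chosen square root of \<open>-1\<close>; only \<open>\<gamma> = (1 + \<iota>) / 2\<close> and \<open>\<gamma> = (1 - \<iota>) / 2\<close>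
  are meaningful.
\<close>

definition alg_G :: "'k::field \<Rightarrow> 'k \<Rightarrow> ('k, 'k free3 set) module"
  where "alg_G \<iota> \<gamma> = (let c = (if \<gamma> = (1 + \<iota>) / 2 then \<iota> else - \<iota>) in presented
    {w1^2 - w2^2, w3 * w1 - w1 * w3, w3^2 * w2 + w2 * w3^2,
     w3 * w1 * w2 + w3 * w2 * w1 + scale c (w1 * w2 * w3) + scale c (w2 * w1 * w3)})"


section \<open>Consistency checks\<close>

lemma carrier_klein_four: "carrier klein_four = {(0, 0), (0, 1), (1, 0), (1, 1)}"
proof -
  have "{0..<2::int} = {0, 1}" by auto
  then show ?thesis
    by (auto simp: klein_four_def DirProd_def integer_mod_group_def)
qed

lemma mult_klein_four:
  "(p, q) \<otimes>\<^bsub>klein_four\<^esub> (r, s) = ((p + r) mod 2, (q + s) mod 2)"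
  by (simp add: klein_four_def DirProd_def integer_mod_group_def)

lemma one_klein_four: "\<one>\<^bsub>klein_four\<^esub> = (0, 0)"
  by (simp add: klein_four_def DirProd_def integer_mod_group_def)

lemma group_klein_four: "group klein_four"
  by (simp add: klein_four_def DirProd_group)

lemma inv_klein_four: "g \<in> carrier klein_four \<Longrightarrow> inv\<^bsub>klein_four\<^esub> g = g"
  by (rule group.inv_equality)
     (use group_klein_four in \<open>auto simp: carrier_klein_four mult_klein_four one_klein_four\<close>)

lemma klein_cocycle_normalised:
  "g \<in> carrier klein_four \<Longrightarrow>
    klein_cocycle \<one>\<^bsub>klein_four\<^esub> g = (1::'k::field) \<and>
    klein_cocycle g \<one>\<^bsub>klein_four\<^esub> = (1::'k)"
  by (auto simp: carrier_klein_four one_klein_four)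

lemma klein_cocycle_cocycle:
  assumes "f \<in> carrier klein_four" "g \<in> carrier klein_four" "h \<in> carrier klein_four"
  shows "klein_cocycle f (g \<otimes>\<^bsub>klein_four\<^esub> h) * klein_cocycle g h =
    (klein_cocycle (f \<otimes>\<^bsub>klein_four\<^esub> g) h * klein_cocycle f g :: 'k::field)"
  using assms by (auto simp: carrier_klein_four mult_klein_four)

lemma klein_char_values:
  "klein_char (1, 0) (1, 0) = (1::'k::field)" "klein_char (1, 0) (0, 1) = (- 1::'k)"
  "klein_char (0, 1) (1, 0) = (- 1::'k)" "klein_char (0, 1) (0, 1) = (1::'k)"
  by simp_all

lemma klein_char_mult:
  assumes "f \<in> carrier klein_four" "g \<in> carrier klein_four" "h \<in> carrier klein_four"
  shows "klein_char (f \<otimes>\<^bsub>klein_four\<^esub> g) h = (klein_char f h * klein_char g h :: 'k::field)"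
    and "klein_char f (g \<otimes>\<^bsub>klein_four\<^esub> h) = (klein_char f g * klein_char f h :: 'k)"
  using assms by (auto simp: carrier_klein_four mult_klein_four)

lemma lookup_scale: "Poly_Mapping.lookup (scale c p) w = c * Poly_Mapping.lookup p w"
  by (simp add: map.rep_eq when_def)

lemma ring_free_algebra: "ring (free_algebra :: ('k::field, 'x word \<Rightarrow>\<^sub>0 'k) module)"
proof (intro ringI abelian_groupI monoidI)
  fix x :: "'x word \<Rightarrow>\<^sub>0 'k"
  show "\<exists>y \<in> carrier free_algebra. y \<oplus>\<^bsub>free_algebra\<^esub> x = \<zero>\<^bsub>free_algebra\<^esub>"
    by (intro bexI[of _ "- x"]) (simp_all add: free_algebra_def)
qed (simp_all add: free_algebra_def algebra_simps)

lemma subst_superset: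
  assumes "finite S" "Poly_Mapping.keys p \<subseteq> S"
  shows "subst f p =
    (\<Sum>w\<in>S. scale (Poly_Mapping.lookup p w) (prod_list (map f (letters w))))"
  unfolding subst_def
  by (rule sum.mono_neutral_left)
     (use assms in \<open>auto simp: in_keys_iff lookup_scale intro!: poly_mapping_eqI\<close>)

lemma scale_add_left: "scale (a + b) p = scale a p + scale b p"
  by (rule poly_mapping_eqI) (simp add: lookup_scale lookup_add algebra_simps)

lemma scale_minus_left: "scale (- a) p = - scale (a::'k::field) p"
  by (rule poly_mapping_eqI) (simp add: lookup_scale)

lemma scale_one: "scale (1::'k::field) p = p"
  by (rule poly_mapping_eqI) (simp add: lookup_scale)

lemma subst_add: "subst f (p + q) = subst f p + subst f q"
proof -
  let ?S = "Poly_Mapping.keys p \<union> Poly_Mapping.keys q"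
  have "Poly_Mapping.keys (p + q) \<subseteq> ?S" by (rule keys_add)
  then show ?thesis
    by (simp add: subst_superset[where S = ?S] lookup_add scale_add_left sum.distrib)
qed

lemma subst_uminus: "subst f (- p) = - subst f p"
  by (simp add: subst_def scale_minus_left sum_negf)

lemma subst_gen: "subst f (gen x) = f x"
  by (simp add: subst_def gen_def scale_one)

lemma w_degrees:
  defines "deg \<equiv> graded_part klein_four klein_char klein_act free_algebra"
  shows "(w1 :: 'k::field free3) \<in> deg (0, 0)"
    and "(w2 :: 'k free3) \<in> deg (0, 1)"
    and "(w3 :: 'k free3) \<in> deg (1, 0)"
  unfolding deg_def graded_part_def
  by (auto simp: carrier_klein_four inv_klein_four free_algebra_def w1_def w2_def w3_def
      diff_conv_add_uminus subst_add subst_uminus subst_gen scale_one scale_minus_left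
      simp del: add_uminus_conv_diff)

lemma conj_gamma:
  fixes \<iota> :: "'k::field_char_0"
  assumes "\<iota>^2 = - 1"
  shows "1 / (2 * ((1 + \<iota>) / 2)) = (1 - \<iota>) / 2"
    and "1 / (2 * ((1 - \<iota>) / 2)) = (1 + \<iota>) / 2"
proof -
  have *: "(1 + \<iota>) * (1 - \<iota>) = 2"
    using assms by (simp add: algebra_simps power2_eq_square)
  then have "1 + \<iota> \<noteq> 0" "1 - \<iota> \<noteq> 0" by auto
  moreover have "2 * ((1 + \<iota>) / 2) = 1 + \<iota>" "2 * ((1 - \<iota>) / 2) = 1 - \<iota>" by simp_all
  ultimately show "1 / (2 * ((1 + \<iota>) / 2)) = (1 - \<iota>) / 2"
    and "1 / (2 * ((1 - \<iota>) / 2)) = (1 + \<iota>) / 2"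
    using * by (simp_all only: frac_eq_eq mult_1 mult.commute zero_neq_numeral[symmetric] not_False_eq_True)
qed

end

theory Submission
  imports Defs
begin

text \<open>
  Lift the twisted product to the free algebra. There the linear map that multiplies a word in
  \<open>w\<^sub>1, w\<^sub>2, w\<^sub>3\<close> by \<open>-1\<close> for every pair of a \<open>w\<^sub>3\<close> and a later \<open>w\<^sub>2\<close> is an involution that turns the
  twisted product into the ordinary one and commutes with the action. Hence it carries an ideal
  generated by homogeneous relations to the ideal generated by their images and induces an
  isomorphism from the twist of the first quotient onto the second; on the defining relations
  one reads off that it exchanges the presentations in question up to sign.
\<close>

section \<open>Linear maps on the free algebra\<close>

lemma scale_add_right: "scale c (p + q) = scale c p + scale (c::'k::field) q"
  by (rule poly_mapping_eqI) (simp add: lookup_scale lookup_add algebra_simps)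

lemma scale_minus_right: "scale c (- p) = - scale (c::'k::field) p"
  by (rule poly_mapping_eqI) (simp add: lookup_scale)

lemma scale_diff_right: "scale c (p - q) = scale c p - scale (c::'k::field) q"
  by (rule poly_mapping_eqI) (simp add: lookup_scale lookup_minus algebra_simps)

lemma scale_scale: "scale a (scale b p) = scale (a * b :: 'k::field) p"
  by (rule poly_mapping_eqI) (simp add: lookup_scale)

lemma scale_zero_left: "scale (0::'k::field) p = 0" "Poly_Mapping.map (\<lambda>_. 0) p = 0"
  by (rule poly_mapping_eqI; simp add: map.rep_eq when_def)+

lemma scale_zero_right: "scale (c::'k::field) 0 = 0"
  by (rule poly_mapping_eqI) (simp add: lookup_scale)

lemma scale_sum: "scale (c::'k::field) (sum f S) = (\<Sum>i\<in>S. scale c (f i))"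
  by (induction S rule: infinite_finite_induct) (simp_all add: scale_add_right scale_zero_right)

lemma scale_diff_left: "scale (a - b) p = scale a p - scale (b::'k::field) p"
  by (rule poly_mapping_eqI) (simp add: lookup_scale lookup_minus algebra_simps)

lemma scale_sum_left: "scale (sum f S) p = (\<Sum>i\<in>S. scale (f i :: 'k::field) p)"
  by (induction S rule: infinite_finite_induct) (simp_all add: scale_add_left scale_zero_left)

text \<open>Updating \<open>p\<close> at a fresh key is adding a monomial to it, so additive
  statements reduce to monomials.\<close>

lemma poly_mapping_add_induct [case_names single add]:
  assumes "\<And>w c. P (Poly_Mapping.single w c)" "\<And>p q. P p \<Longrightarrow> P q \<Longrightarrow> P (p + q)"
  shows "P p"
proof (induction p rule: update_induct)
  case const
  then show ?case using assms(1)[of undefined 0] by simp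
next
  case (update p w c)
  have "Poly_Mapping.update w c p = p + Poly_Mapping.single w c"
    by (rule poly_mapping_eqI)
       (use update in \<open>auto simp: lookup_update lookup_add lookup_single in_keys_iff when_def\<close>)
  then show ?case using update assms by metis
qed

lemma scale_mult_left: "scale (c::'k::field) p * q = scale c (p * q)"
  for p :: "'x word \<Rightarrow>\<^sub>0 'k::field"
  by (simp add: mult_map_scale_conv_mult mult.assoc)

lemma mult_scale_right: "p * scale (c::'k::field) q = scale c (p * q)"
  for p :: "'x word \<Rightarrow>\<^sub>0 'k::field"
proof (induction p rule: poly_mapping_add_induct)
  case (single w a)
  show ?case
    by (induction q rule: poly_mapping_add_induct)
       (simp_all add: mult_single scale_add_right distrib_left mult.left_commute)
qed (simp add: distrib_right scale_add_right)

lemma one_eq_single: "(1 :: 'x word \<Rightarrow>\<^sub>0 'k::field) = Poly_Mapping.single (Word []) 1"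
  by (metis single_one zero_word_def)

lemma single_Cons:
  "Poly_Mapping.single (Word (x # xs)) c = gen x * Poly_Mapping.single (Word xs) (c::'k::field)"
  by (simp add: gen_def mult_single plus_word_def)

text \<open>Words are built from 1 by left multiplication with generators. For linear maps only the
  cases \<open>one\<close> and \<open>gen\<close> then carry content.\<close>

lemma free_algebra_induct [case_names one add scale gen]:
  fixes p :: "'x word \<Rightarrow>\<^sub>0 'k::field"
  assumes one: "P 1" and add: "\<And>p q. P p \<Longrightarrow> P q \<Longrightarrow> P (p + q)"
    and scale: "\<And>c p. P p \<Longrightarrow> P (scale c p)" and gen: "\<And>x p. P p \<Longrightarrow> P (gen x * p)"
  shows "P p"
proof (induction p rule: poly_mapping_add_induct)
  case (single w c)
  have "P (Poly_Mapping.single (Word xs) 1)" for xs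
    by (induction xs) (simp_all add: one gen single_Cons flip: one_eq_single)
  then have "P (scale c (Poly_Mapping.single (Word (letters w)) 1))"
    by (rule scale)
  then show ?case by simp
qed (rule add)

section \<open>Linear maps prescribed on words\<close>

text \<open>Common form of \<open>subst\<close> and the later \<open>twist_map\<close>; the values
  on words need not be multiplicative.\<close>

definition word_extend ::
    "('x list \<Rightarrow> ('x word \<Rightarrow>\<^sub>0 'k::field)) \<Rightarrow> ('x word \<Rightarrow>\<^sub>0 'k) \<Rightarrow> ('x word \<Rightarrow>\<^sub>0 'k)"
  where "word_extend h p =
    (\<Sum>w\<in>Poly_Mapping.keys p. scale (Poly_Mapping.lookup p w) (h (letters w)))"

lemma word_extend_superset:
  assumes "finite S" "Poly_Mapping.keys p \<subseteq> S"
  shows "word_extend h p = (\<Sum>w\<in>S. scale (Poly_Mapping.lookup p w) (h (letters w)))"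
  unfolding word_extend_def
  by (rule sum.mono_neutral_left)
     (use assms in \<open>auto simp: in_keys_iff scale_zero_left\<close>)

lemma word_extend_add: "word_extend h (p + q) = word_extend h p + word_extend h q"
proof -
  let ?S = "Poly_Mapping.keys p \<union> Poly_Mapping.keys q"
  have "Poly_Mapping.keys (p + q) \<subseteq> ?S" by (rule keys_add)
  then show ?thesis
    by (simp add: word_extend_superset[where S = ?S] lookup_add scale_add_left sum.distrib)
qed

lemma word_extend_scale: "word_extend h (scale c p) = scale c (word_extend h p)"
proof -
  have "Poly_Mapping.keys (scale c p) \<subseteq> Poly_Mapping.keys p"
    by (auto simp: in_keys_iff lookup_scale)
  then show ?thesis
    by (simp add: word_extend_superset[where S = "Poly_Mapping.keys p"] lookup_scale scale_sum
        scale_scale)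
qed

lemma word_extend_single: "word_extend h (Poly_Mapping.single (Word xs) c) = scale c (h xs)"
  by (simp add: word_extend_def scale_zero_left)

lemma word_extend_one: "word_extend h 1 = h []"
  by (simp add: one_eq_single word_extend_single scale_one)

text \<open>Both sides are additive in \<open>p\<close>, so the recursion of \<open>h\<close> need
  only be compared on monomials. It yields multiplicativity of \<open>subst\<close> and the
  recursion for \<open>twist_map\<close>.\<close>

lemma word_extend_gen_mult:
  assumes "\<And>xs. h (x # xs) = L (h xs)" "\<And>p q. L (p + q) = L p + L q"
    "\<And>c p. L (scale c p) = scale c (L p)"
  shows "word_extend h (gen x * p) = L (word_extend h p)"
proof (induction p rule: poly_mapping_add_induct)
  case (single w c)
  then show ?case
    using assms by (cases w) (simp add: word_extend_single flip: single_Cons)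
qed (simp add: algebra_simps word_extend_add assms)

lemma subst_eq_word_extend: "subst f = word_extend (\<lambda>xs. prod_list (map f xs))"
  by (simp add: fun_eq_iff subst_def word_extend_def)

lemma subst_scale: "subst f (scale c p) = scale c (subst f p)"
  by (simp add: subst_eq_word_extend word_extend_scale)

lemma subst_diff: "subst f (p - q) = subst f p - subst f q"
  using subst_add[of f p "- q"] by (simp add: subst_uminus)

lemma subst_one: "subst f 1 = 1"
  by (simp add: subst_eq_word_extend word_extend_one)

lemma subst_mult: "subst f (p * q) = subst f p * subst f q"
proof (induction p rule: free_algebra_induct)
  case (gen x p)
  have *: "subst f (gen x * p) = f x * subst f p" for p
    unfolding subst_eq_word_extend
    by (rule word_extend_gen_mult) (simp_all add: algebra_simps mult_scale_right)
  show ?case by (simp add: mult.assoc * gen)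
qed (simp_all add: subst_one subst_add subst_scale algebra_simps scale_mult_left)

lemma subst_subst: "subst f (subst g p) = subst (\<lambda>x. subst f (g x)) p"
  by (induction p rule: free_algebra_induct)
     (simp_all add: subst_one subst_add subst_scale subst_mult subst_gen)

lemma subst_gen_id: "subst gen p = p"
  by (induction p rule: free_algebra_induct)
     (simp_all add: subst_one subst_add subst_scale subst_mult subst_gen)

lemmas subst_simps = subst_add subst_uminus subst_diff subst_scale subst_one subst_mult subst_gen


section \<open>The twisted product on the free algebra\<close>

abbreviation swap :: "'k::field free3 \<Rightarrow> 'k free3" where "swap \<equiv> subst g1_on_gens"
abbreviation neg :: "'k::field free3 \<Rightarrow> 'k free3" where "neg \<equiv> subst g2_on_gens"

text \<open>A composite of substitutions is again a substitution, hence determined by its values on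
  the three generators. The next two lemmas use the same principle.\<close>

lemma swap_swap: "swap (swap p) = (p :: 'k::field free3)"
proof -
  have "(\<lambda>x. swap (g1_on_gens x)) = (gen :: var \<Rightarrow> 'k free3)"
    by (rule ext) (case_tac x; simp add: subst_simps)
  then show ?thesis by (simp add: subst_subst subst_gen_id)
qed

lemma neg_neg: "neg (neg p) = (p :: 'k::field free3)"
proof -
  have "(\<lambda>x. neg (g2_on_gens x)) = (gen :: var \<Rightarrow> 'k free3)"
    by (rule ext) (case_tac x; simp add: subst_simps)
  then show ?thesis by (simp add: subst_subst subst_gen_id)
qed

lemma neg_swap: "neg (swap p) = swap (neg (p :: 'k::field free3))"
proof -
  have "(\<lambda>x. neg (g1_on_gens x)) = (\<lambda>x. swap (g2_on_gens x) :: 'k free3)"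
    by (rule ext) (case_tac x; simp add: subst_simps)
  then show ?thesis by (simp add: subst_subst)
qed

text \<open>Together with \<open>odd3\<close>, the projections onto the eigenspaces of
  \<open>neg\<close> for 1 and -1, that is, onto even and odd degree in \<open>w3\<close>.\<close>

definition even3 :: "'k::field_char_0 free3 \<Rightarrow> 'k free3"
  where "even3 p = scale (1/2) (p + neg p)"

definition odd3 :: "'k::field_char_0 free3 \<Rightarrow> 'k free3"
  where "odd3 p = scale (1/2) (p - neg p)"

text \<open>
  The cocycle is \<open>-1\<close> exactly when the left factor has odd degree in \<^const>\<open>w3\<close> and the right
  factor has odd degree in \<^const>\<open>w2\<close>, and \<^const>\<open>g1_on_gens\<close> is the sign of the degree in
  \<^const>\<open>w2\<close>.
\<close>

definition star :: "'k::field_char_0 free3 \<Rightarrow> 'k free3 \<Rightarrow> 'k free3"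
  where "star p q = even3 p * q + odd3 p * swap q"

lemma even3_add_odd3: "even3 p + odd3 p = p"
  by (rule poly_mapping_eqI)
     (simp add: even3_def odd3_def lookup_add lookup_minus lookup_scale field_simps)

lemma neg_even3: "neg (even3 p) = even3 p"
  by (simp add: even3_def subst_simps neg_neg add.commute)

lemma neg_odd3: "neg (odd3 p) = - odd3 p"
  by (simp add: odd3_def subst_simps neg_neg flip: scale_minus_right)

lemma even3_eq: "neg p = p \<Longrightarrow> even3 p = p" and odd3_eq_0: "neg p = p \<Longrightarrow> odd3 p = 0"
  using even3_add_odd3[of p] by (auto simp: odd3_def scale_zero_right)

lemma odd3_eq: "neg p = - p \<Longrightarrow> odd3 p = p" and even3_eq_0: "neg p = - p \<Longrightarrow> even3 p = 0"
  using even3_add_odd3[of p] by (auto simp: even3_def scale_zero_right)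

lemma parity_add: "even3 (p + q) = even3 p + even3 q" "odd3 (p + q) = odd3 p + odd3 q"
  by (simp_all add: even3_def odd3_def subst_add scale_add_right scale_diff_right)

lemma parity_scale: "even3 (scale c p) = scale c (even3 p)" "odd3 (scale c p) = scale c (odd3 p)"
  by (simp_all add: even3_def odd3_def subst_scale scale_add_right scale_diff_right scale_scale
      mult.commute)

text \<open>As \<open>neg\<close> is multiplicative, parities add in products.\<close>

lemma parity_mult_even:
  "even3 (even3 p * q) = even3 p * even3 q" "odd3 (even3 p * q) = even3 p * odd3 q"
  by (simp_all add: even3_def[of "_ * _"] odd3_def[of "_ * _"] even3_def[of q] odd3_def[of q]
      subst_mult neg_even3 mult_scale_right algebra_simps)

lemma parity_mult_odd:
  "even3 (odd3 p * q) = odd3 p * odd3 q" "odd3 (odd3 p * q) = odd3 p * even3 q"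
  by (simp_all add: even3_def[of "_ * _"] odd3_def[of "_ * _"] even3_def[of q] odd3_def[of q]
      subst_mult neg_odd3 mult_scale_right algebra_simps)

lemma swap_parity: "swap (even3 p) = even3 (swap p)" "swap (odd3 p) = odd3 (swap p)"
  by (simp_all add: even3_def odd3_def subst_simps neg_swap)

lemma parity_neg: "even3 (neg p) = even3 p" "odd3 (neg p) = - odd3 p"
  by (simp_all add: even3_def odd3_def neg_neg add.commute flip: scale_minus_right)

lemma star_add_left: "star (p + q) r = star p r + star q r"
  and star_add_right: "star r (p + q) = star r p + star r q"
  by (simp_all add: star_def parity_add subst_add algebra_simps)

lemma star_scale_left: "star (scale c p) q = scale c (star p q)"
  and star_scale_right: "star p (scale c q) = scale c (star p q)"
  by (simp_all add: star_def parity_scale subst_scale scale_mult_left mult_scale_right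
      scale_add_right)

lemma star_one_left: "star 1 p = p"
  by (simp add: star_def even3_eq odd3_eq_0 subst_one)

text \<open>On both sides \<open>swap\<close> hits \<open>r\<close> once for each odd factor to its
  left, and two swaps cancel; \<open>swap\<close> also preserves parity.\<close>

lemma star_assoc: "star (star p q) r = star p (star q r)"
  by (simp add: star_def parity_add parity_mult_even parity_mult_odd subst_add subst_mult
      swap_parity swap_swap algebra_simps)

text \<open>Since \<open>swap\<close> and \<open>neg\<close> commute, both remain automorphisms for
  the twisted product.\<close>

lemma swap_star: "swap (star p q) = star (swap p) (swap q)"
  by (simp add: star_def subst_add subst_mult swap_parity)

lemma neg_star: "neg (star p q) = star (neg p) (neg q)"
  by (simp add: star_def subst_add subst_mult neg_even3 neg_odd3 parity_neg neg_swap)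

section \<open>The involution between the two products\<close>

text \<open>The homomorphism from the free algebra to the same space under \<open>star\<close> that
  fixes the generators. Iterated \<open>star\<close> products in place of signs allow a definition
  on words in the original generators instead of the \<open>w\<close>'s.\<close>

definition twist_map :: "'k::field_char_0 free3 \<Rightarrow> 'k free3"
  where "twist_map = word_extend (\<lambda>xs. foldr (\<lambda>x. star (gen x)) xs 1)"

lemma twist_map_add: "twist_map (p + q) = twist_map p + twist_map q"
  by (simp add: twist_map_def word_extend_add)

lemma twist_map_scale: "twist_map (scale c p) = scale c (twist_map p)"
  by (simp add: twist_map_def word_extend_scale)

lemma twist_map_uminus: "twist_map (- p) = - twist_map p"
  using twist_map_scale[of "- 1" p] by (simp only: scale_minus_left scale_one)

lemma twist_map_diff: "twist_map (p - q) = twist_map p - twist_map q"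
  using twist_map_add[of p "- q"] by (simp add: twist_map_uminus)

lemma twist_map_one: "twist_map 1 = 1"
  by (simp add: twist_map_def word_extend_one)

lemma twist_map_gen_mult: "twist_map (gen x * p) = star (gen x) (twist_map p)"
  unfolding twist_map_def
  by (rule word_extend_gen_mult) (simp_all add: star_add_right star_scale_right)

lemma star_gen:
  "star (gen X1) p = gen X1 * p" "star (gen X2) p = gen X2 * p" "star (gen X3) p = gen X3 * swap p"
  by (simp_all add: star_def even3_eq odd3_eq_0 odd3_eq even3_eq_0 subst_gen)

lemma twist_map_gen: "twist_map (gen x) = gen x"
  using twist_map_gen_mult[of x 1]
  by (cases x) (simp_all add: twist_map_one star_gen subst_one)

text \<open>Associativity of \<open>star\<close> lets generators be peeled off the left
  factor.\<close>

lemma twist_map_mult: "twist_map (p * q) = star (twist_map p) (twist_map q)"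
  by (induction p rule: free_algebra_induct)
     (simp_all add: twist_map_one star_one_left distrib_right twist_map_add star_add_left
      scale_mult_left twist_map_scale star_scale_left mult.assoc twist_map_gen_mult star_assoc)

lemma twist_map_swap: "twist_map (swap p) = swap (twist_map (p :: 'k::field_char_0 free3))"
proof (induction p rule: free_algebra_induct)
  case (gen x p)
  have "twist_map (swap (gen x)) = (swap (gen x) :: 'k free3)"
    by (cases x) (simp_all add: subst_gen twist_map_gen)
  then show ?case
    by (simp add: subst_mult twist_map_mult swap_star gen twist_map_gen)
qed (simp_all add: subst_simps twist_map_one twist_map_add twist_map_scale)

lemma twist_map_neg: "twist_map (neg p) = neg (twist_map (p :: 'k::field_char_0 free3))"
proof (induction p rule: free_algebra_induct)
  case (gen x p)
  have "twist_map (neg (gen x)) = (neg (gen x) :: 'k free3)"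
    by (cases x) (simp_all add: subst_gen twist_map_gen twist_map_uminus)
  then show ?case
    by (simp add: subst_mult twist_map_mult neg_star gen twist_map_gen)
qed (simp_all add: subst_simps twist_map_one twist_map_add twist_map_scale)

lemma twist_map_parity:
  "twist_map (even3 p) = even3 (twist_map p)" "twist_map (odd3 p) = odd3 (twist_map p)"
  by (simp_all add: even3_def odd3_def twist_map_scale twist_map_add twist_map_diff twist_map_neg)

text \<open>The odd part of the left factor meets one \<open>swap\<close> from
  \<open>star p q\<close> and another from \<open>twist_map_mult\<close>; they cancel and the
  ordinary product is left.\<close>

lemma twist_map_star: "twist_map (star p q) = twist_map p * twist_map q"
proof -
  have "twist_map (star p q) = star (even3 (twist_map p)) (twist_map q)
      + star (odd3 (twist_map p)) (swap (twist_map q))"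
    by (simp add: star_def[of p] twist_map_add twist_map_mult twist_map_parity twist_map_swap)
  also have "\<dots> = (even3 (twist_map p) + odd3 (twist_map p)) * twist_map q"
    by (simp add: star_def even3_eq odd3_eq_0 neg_even3 odd3_eq even3_eq_0 neg_odd3 swap_swap
        distrib_right)
  finally show ?thesis by (simp add: even3_add_odd3)
qed

text \<open>The composite respects the ordinary product and fixes the generators.\<close>

lemma twist_map_twist_map: "twist_map (twist_map p) = p"
  by (induction p rule: free_algebra_induct)
     (simp_all add: twist_map_one twist_map_add twist_map_scale twist_map_gen_mult twist_map_star
      twist_map_gen)


section \<open>Quotients of the free algebra\<close>

lemma free_algebra_simps:
  "carrier free_algebra = UNIV" "p \<otimes>\<^bsub>free_algebra\<^esub> q = p * q"
  "p \<oplus>\<^bsub>free_algebra\<^esub> q = p + q" "\<one>\<^bsub>free_algebra\<^esub> = 1" "\<zero>\<^bsub>free_algebra\<^esub> = 0"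
  "c \<odot>\<^bsub>free_algebra\<^esub> p = scale c p"
  by (simp_all add: free_algebra_def)

lemma free_algebra_uminus: "\<ominus>\<^bsub>free_algebra\<^esub> p = - p"
proof -
  interpret ring free_algebra by (rule ring_free_algebra)
  show ?thesis
    by (rule minus_equality) (simp_all add: free_algebra_simps)
qed

text \<open>Negatives come from multiplication by -1.\<close>

lemma free_idealI:
  fixes I :: "('x word \<Rightarrow>\<^sub>0 'k::field) set"
  assumes "0 \<in> I" "\<And>p q. p \<in> I \<Longrightarrow> q \<in> I \<Longrightarrow> p + q \<in> I"
    "\<And>p q. q \<in> I \<Longrightarrow> p * q \<in> I" "\<And>p q. q \<in> I \<Longrightarrow> q * p \<in> I"
  shows "ideal I free_algebra"
proof (rule idealI)
  interpret ring "free_algebra :: ('k, 'x word \<Rightarrow>\<^sub>0 'k) module" by (rule ring_free_algebra)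
  have "- p \<in> I" if "p \<in> I" for p
    using assms(3)[OF that, of "- 1"] by simp
  then show "subgroup I (add_monoid free_algebra)"
    using assms by (intro add.subgroupI)
      (auto simp: free_algebra_simps free_algebra_uminus simp flip: a_inv_def)
qed (use assms in \<open>simp_all add: free_algebra_simps ring_free_algebra\<close>)

locale free_ideal =
  fixes I :: "('x word \<Rightarrow>\<^sub>0 'k::field) set"
  assumes is_ideal: "ideal I free_algebra"
begin

interpretation ideal I free_algebra by (rule is_ideal)

lemma zero_in: "0 \<in> I"
  using additive_subgroup.zero_closed[OF ideal.axioms(1)[OF is_ideal]]
  by (simp add: free_algebra_simps)

lemma add_in: "p \<in> I \<Longrightarrow> q \<in> I \<Longrightarrow> p + q \<in> I"
  using additive_subgroup.a_closed[OF ideal.axioms(1)[OF is_ideal], of p q]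
  by (simp add: free_algebra_simps)

lemma mult_left_in: "q \<in> I \<Longrightarrow> p * q \<in> I"
  using I_l_closed[of q p] by (simp add: free_algebra_simps)

lemma mult_right_in: "q \<in> I \<Longrightarrow> q * p \<in> I"
  using I_r_closed[of q p] by (simp add: free_algebra_simps)

lemma scale_in: "p \<in> I \<Longrightarrow> scale c p \<in> I"
  by (simp add: mult_map_scale_conv_mult mult_left_in)

lemma uminus_in: "p \<in> I \<Longrightarrow> - p \<in> I"
  using mult_left_in[of p "- 1"] by simp

lemma diff_in: "p \<in> I \<Longrightarrow> q \<in> I \<Longrightarrow> p - q \<in> I"
  using add_in[of p "- q"] uminus_in by simp

lemma sum_in: "(\<And>i. i \<in> S \<Longrightarrow> f i \<in> I) \<Longrightarrow> sum f S \<in> I"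
  by (induction S rule: infinite_finite_induct) (auto simp: zero_in add_in)

end

section \<open>Cosets and the operations of the quotient\<close>

definition cls :: "('x word \<Rightarrow>\<^sub>0 'k::field) set \<Rightarrow> ('x word \<Rightarrow>\<^sub>0 'k) \<Rightarrow> ('x word \<Rightarrow>\<^sub>0 'k) set"
  where "cls I p = I +>\<^bsub>free_algebra\<^esub> p"

lemma cls_eq_image: "cls I p = (\<lambda>i. i + p) ` I"
  by (auto simp: cls_def a_r_coset_def' free_algebra_simps)

lemma mem_cls_iff: "q \<in> cls I p \<longleftrightarrow> q - p \<in> I"
  by (force simp: cls_eq_image image_iff algebra_simps)

text \<open>Serves both the group action on cosets and the isomorphism induced by
  \<open>twist_map\<close>.\<close>

lemma image_cls:
  assumes "\<And>p q. f (p + q) = f p + f q"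
  shows "f ` cls I p = cls (f ` I) (f p)"
  by (force simp: cls_eq_image assms)

context free_ideal
begin

interpretation ideal I free_algebra by (rule is_ideal)

lemma cls_eq_iff: "cls I p = cls I q \<longleftrightarrow> p - q \<in> I"
proof
  assume "cls I p = cls I q"
  moreover have "p \<in> cls I p" by (simp add: mem_cls_iff zero_in)
  ultimately show "p - q \<in> I" by (simp add: mem_cls_iff)
next
  assume pq: "p - q \<in> I"
  show "cls I p = cls I q"
    using add_in[OF _ pq] diff_in[OF _ pq] by (force simp: mem_cls_iff)
qed

abbreviation quot where "quot \<equiv> quot_algebra free_algebra I"

lemma carrier_quot: "carrier quot = range (cls I)"
  by (auto simp: quot_algebra_def ring.defs FactRing_def A_RCOSETS_def' cls_def free_algebra_simps(1))

lemma mult_quot: "cls I p \<otimes>\<^bsub>quot\<^esub> cls I q = cls I (p * q)"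
  using rcoset_mult_add[of p q]
  by (simp add: quot_algebra_def ring.defs FactRing_def cls_def free_algebra_simps)

lemma add_quot: "cls I p \<oplus>\<^bsub>quot\<^esub> cls I q = cls I (p + q)"
  using a_rcos_sum[of p q]
  by (simp add: quot_algebra_def ring.defs FactRing_def cls_def free_algebra_simps)

lemma one_quot: "\<one>\<^bsub>quot\<^esub> = cls I 1"
  by (simp add: quot_algebra_def ring.defs FactRing_def cls_def free_algebra_simps)

lemma zero_quot: "\<zero>\<^bsub>quot\<^esub> = cls I 0"
  by (simp add: quot_algebra_def ring.defs FactRing_def cls_eq_image)

text \<open>The union in \<open>quot_algebra\<close> runs over cosets that all coincide, because
  \<open>I\<close> is closed under scalars.\<close>

lemma smult_quot: "c \<odot>\<^bsub>quot\<^esub> cls I p = cls I (scale c p)"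
proof -
  have "cls I (scale c q) = cls I (scale c p)" if "q \<in> cls I p" for q
    using that by (simp add: cls_eq_iff mem_cls_iff scale_in flip: scale_diff_right)
  moreover have "p \<in> cls I p" by (simp add: mem_cls_iff zero_in)
  ultimately have "(\<Union>q\<in>cls I p. cls I (scale c q)) = cls I (scale c p)" by blast
  then show ?thesis
    by (simp add: quot_algebra_def ring.defs module.defs cls_def free_algebra_simps)
qed

lemma abelian_monoid_quot: "abelian_monoid quot"
  by (rule abelian_monoidI) (auto simp: carrier_quot add_quot zero_quot algebra_simps)

lemma finsum_quot:
  assumes "finite S" "\<And>s. s \<in> S \<Longrightarrow> f s = cls I (y s)"
  shows "finsum quot f S = cls I (sum y S)"
  using assms
proof (induction S)
  case empty
  then show ?case
    by (simp add: abelian_monoid.finsum_empty[OF abelian_monoid_quot] zero_quot)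
next
  case (insert s S)
  then have "f \<in> S \<rightarrow> carrier quot" "f s \<in> carrier quot"
    by (auto simp: carrier_quot)
  with insert show ?case
    by (simp add: abelian_monoid.finsum_insert[OF abelian_monoid_quot] add_quot)
qed

end

text \<open>The preimage of \<open>J\<close> is an ideal containing \<open>R\<close>.
  Multiplicativity of \<open>f\<close> is not assumed, so that \<open>twist_map\<close> is covered
  besides \<open>swap\<close> and \<open>neg\<close>.\<close>

lemma Idl_image_subset:
  fixes f :: "('x word \<Rightarrow>\<^sub>0 'k::field) \<Rightarrow> ('y word \<Rightarrow>\<^sub>0 'k)"
  assumes "free_ideal J" and add: "\<And>p q. f (p + q) = f p + f q"
    and "\<And>p q. f q \<in> J \<Longrightarrow> f (p * q) \<in> J" "\<And>p q. f q \<in> J \<Longrightarrow> f (q * p) \<in> J"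
    and "f ` R \<subseteq> J"
  shows "f ` (Idl\<^bsub>free_algebra\<^esub> R) \<subseteq> J"
proof -
  interpret J: free_ideal J by fact
  interpret ring "free_algebra :: ('k, 'x word \<Rightarrow>\<^sub>0 'k) module" by (rule ring_free_algebra)
  have "f 0 = 0" using add[of 0 0] by simp
  then have "ideal (f -` J) free_algebra"
    by (intro free_idealI) (simp_all add: assms J.zero_in J.add_in)
  then have "Idl\<^bsub>free_algebra\<^esub> R \<subseteq> f -` J"
    by (rule genideal_minimal) (use assms in auto)
  then show ?thesis by auto
qed

lemma free_ideal_Idl: "free_ideal (Idl\<^bsub>free_algebra\<^esub> R)"
  by (intro free_ideal.intro ring.genideal_ideal ring_free_algebra) (simp add: free_algebra_simps)

lemma subset_Idl: "R \<subseteq> Idl\<^bsub>free_algebra\<^esub> R"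
  by (intro ring.genideal_self ring_free_algebra) (simp add: free_algebra_simps)


section \<open>The twist of a quotient by a homogeneous ideal\<close>

lemma klein_act_simps:
  "klein_act (0, 0) p = p" "klein_act (0, 1) p = neg p"
  "klein_act (1, 0) p = swap p" "klein_act (1, 1) p = swap (neg p)"
  by simp_all

declare klein_act.simps [simp del]

lemma sum_klein_four:
  "(\<Sum>g\<in>carrier klein_four. f g) = f (0, 0) + f (0, 1) + f (1, 0) + f (1, 1)"
  by (simp add: carrier_klein_four add.assoc)

lemma finite_klein_four: "finite (carrier klein_four)"
  by (simp add: carrier_klein_four)

lemma klein_act_add:
  "g \<in> carrier klein_four \<Longrightarrow> klein_act g (p + q) = klein_act g p + klein_act g q"
  by (auto simp: carrier_klein_four klein_act_simps subst_add)

lemma klein_act_klein_act: "g \<in> carrier klein_four \<Longrightarrow> klein_act g (klein_act g p) = p"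
  by (auto simp: carrier_klein_four klein_act_simps neg_swap swap_swap neg_neg)

text \<open>The averaging projection onto the part of degree \<open>g\<close>; the characters take
  the values 1 and -1, so they equal their inverses.\<close>

definition klein_proj :: "int \<times> int \<Rightarrow> 'k::field_char_0 free3 \<Rightarrow> 'k free3"
  where "klein_proj g p = (\<Sum>h\<in>carrier klein_four. scale (klein_char g h / 4) (klein_act h p))"

lemma klein_proj_add: "klein_proj g (p + q) = klein_proj g p + klein_proj g q"
  unfolding klein_proj_def
  by (simp add: klein_act_add scale_add_right sum.distrib)

lemma klein_proj_zero: "klein_proj g 0 = 0"
  using klein_proj_add[of g 0 0] by simp

lemma klein_proj_sum: "klein_proj g (sum f S) = (\<Sum>i\<in>S. klein_proj g (f i))"
  by (induction S rule: infinite_finite_induct) (simp_all add: klein_proj_add klein_proj_zero)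

lemma klein_proj_diff: "klein_proj g (p - q) = klein_proj g p - klein_proj g q"
  using klein_proj_add[of g "p - q" q] by (simp add: algebra_simps)

lemma klein_act_proj:
  "g \<in> carrier klein_four \<Longrightarrow> h \<in> carrier klein_four \<Longrightarrow>
    klein_act h (klein_proj g p) = scale (klein_char g h) (klein_proj g p)"
  unfolding klein_proj_def sum_klein_four
  by (auto simp: carrier_klein_four klein_act_simps subst_simps neg_swap swap_swap neg_neg
      scale_add_right scale_scale scale_minus_left scale_minus_right scale_one algebra_simps)

text \<open>After exchanging the sums, orthogonality kills the coefficient of every group element
  but the identity.\<close>

lemma sum_klein_proj: "(\<Sum>g\<in>carrier klein_four. klein_proj g p) = p"
proof -
  have "(\<Sum>g\<in>carrier klein_four. klein_proj g p) =
      (\<Sum>h\<in>carrier klein_four. scale (\<Sum>g\<in>carrier klein_four. klein_char g h / 4) (klein_act h p))"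
    unfolding klein_proj_def by (subst sum.swap) (simp only: scale_sum_left)
  also have "\<dots> = p"
    by (simp add: sum_klein_four klein_act_simps scale_zero_left scale_one)
  finally show ?thesis .
qed

lemma klein_char_orthogonal:
  assumes "g \<in> carrier klein_four" "g' \<in> carrier klein_four"
  shows "(\<Sum>h\<in>carrier klein_four. klein_char g h / 4 * klein_char g' h) =
    (if g = g' then 1 else 0 :: 'k::field_char_0)"
proof -
  have "(\<Sum>h\<in>carrier klein_four. klein_char g h * klein_char g' h) = (if g = g' then 4 else 0 :: 'k)"
    using assms unfolding sum_klein_four carrier_klein_four insert_iff empty_iff
    by (elim disjE FalseE; hypsubst; simp)
  then show ?thesis
    by (simp flip: sum_divide_distrib)
qed

text \<open>The cocycle sees only the first coordinate of \<open>g\<close> and the second of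
  \<open>h\<close>. Hence the \<open>p\<close> side groups into \<open>even3 p\<close> and
  \<open>odd3 p\<close>, paired with the plain and the signed sum of the components of
  \<open>q\<close>.\<close>

lemma sum_klein_cocycle_proj:
  "(\<Sum>g\<in>carrier klein_four. \<Sum>h\<in>carrier klein_four.
      scale (klein_cocycle g h) (klein_proj g p * klein_proj h q)) = star p q"
proof -
  have "klein_proj (0, 0) p + klein_proj (0, 1) p =
      (\<Sum>h\<in>carrier klein_four. scale (klein_char (0, 0) h / 4 + klein_char (0, 1) h / 4) (klein_act h p))"
    by (simp only: klein_proj_def scale_add_left sum.distrib)
  also have "\<dots> = even3 p"
    by (simp add: sum_klein_four klein_act_simps even3_def scale_add_right scale_zero_left)
  finally have even3: "klein_proj (0, 0) p + klein_proj (0, 1) p = even3 p" .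
  have "klein_proj (1, 0) p + klein_proj (1, 1) p =
      (\<Sum>h\<in>carrier klein_four. scale (klein_char (1, 0) h / 4 + klein_char (1, 1) h / 4) (klein_act h p))"
    by (simp only: klein_proj_def scale_add_left sum.distrib)
  also have "\<dots> = odd3 p"
    by (simp add: sum_klein_four klein_act_simps odd3_def scale_diff_right scale_minus_left scale_zero_left)
  finally have odd3: "klein_proj (1, 0) p + klein_proj (1, 1) p = odd3 p" .
  have q: "klein_proj (0, 0) q + klein_proj (0, 1) q + klein_proj (1, 0) q + klein_proj (1, 1) q = q"
    using sum_klein_proj[of q] by (simp add: sum_klein_four)
  \<comment> \<open>The signs are the values of \<open>klein_cocycle (1, j)\<close>, and also the
    eigenvalues of \<open>swap\<close> on the components.\<close>
  have "klein_proj (0, 0) q - klein_proj (0, 1) q + klein_proj (1, 0) q - klein_proj (1, 1) q =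
      (\<Sum>h\<in>carrier klein_four. scale (klein_char (0, 0) h / 4 - klein_char (0, 1) h / 4
        + klein_char (1, 0) h / 4 - klein_char (1, 1) h / 4) (klein_act h q))"
    by (simp only: klein_proj_def scale_add_left scale_diff_left sum.distrib sum_subtractf)
  also have "\<dots> = swap q"
    by (simp add: sum_klein_four klein_act_simps scale_zero_left scale_one)
  finally have swap: "klein_proj (0, 0) q - klein_proj (0, 1) q + klein_proj (1, 0) q
      - klein_proj (1, 1) q = swap q" .
  have "(\<Sum>h\<in>carrier klein_four. scale (klein_cocycle g h) (klein_proj g p * klein_proj h q)) =
      klein_proj g p * (\<Sum>h\<in>carrier klein_four. scale (klein_cocycle g h) (klein_proj h q))" for g
    by (simp only: sum_distrib_left mult_scale_right)
  moreover have "(\<Sum>h\<in>carrier klein_four. scale (klein_cocycle (0, j) h) (klein_proj h q)) = q" for j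
    using q by (simp add: sum_klein_four scale_one)
  moreover have "(\<Sum>h\<in>carrier klein_four. scale (klein_cocycle (1, j) h) (klein_proj h q)) = swap q" for j
    using swap by (simp add: sum_klein_four scale_one scale_minus_left)
  ultimately show ?thesis
    by (simp only: sum_klein_four[of "\<lambda>g. klein_proj g p * f g" for f] star_def even3[symmetric]
        odd3[symmetric] distrib_right add.assoc)
qed

section \<open>Ideals stable under the action\<close>

locale klein_ideal = free_ideal I for I :: "'k::field_char_0 free3 set" +
  assumes swap_in: "p \<in> I \<Longrightarrow> swap p \<in> I" and neg_in: "p \<in> I \<Longrightarrow> neg p \<in> I"
begin

lemma klein_act_in: "g \<in> carrier klein_four \<Longrightarrow> p \<in> I \<Longrightarrow> klein_act g p \<in> I"
  by (auto simp: carrier_klein_four klein_act_simps swap_in neg_in)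

lemma klein_act_image_cls:
  assumes "g \<in> carrier klein_four"
  shows "klein_act g ` cls I p = cls I (klein_act g p)"
proof -
  \<comment> \<open>Stability gives one inclusion; the other follows because \<open>g\<close> acts
    as an involution.\<close>
  have "klein_act g ` I = I"
    using klein_act_in[OF assms] klein_act_klein_act[OF assms]
    by (metis imageI image_subsetI subsetI subset_antisym)
  then show ?thesis
    by (simp add: image_cls klein_act_add assms)
qed

lemma klein_proj_in: "p \<in> I \<Longrightarrow> klein_proj g p \<in> I"
  unfolding klein_proj_def by (intro sum_in scale_in klein_act_in)

lemma even3_in: "p \<in> I \<Longrightarrow> even3 p \<in> I" and odd3_in: "p \<in> I \<Longrightarrow> odd3 p \<in> I"
  by (simp_all add: even3_def odd3_def scale_in add_in diff_in neg_in)

lemma star_left_in: "q \<in> I \<Longrightarrow> star p q \<in> I"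
  by (simp add: star_def add_in mult_left_in swap_in)

lemma star_right_in: "q \<in> I \<Longrightarrow> star q p \<in> I"
  by (simp add: star_def add_in mult_right_in even3_in odd3_in)

abbreviation graded where
  "graded \<equiv> graded_part klein_four klein_char (\<lambda>g X. klein_act g ` X) quot"

text \<open>Homogeneity in the quotient is only an eigenvector condition modulo \<open>I\<close> on
  an arbitrary representative.\<close>

lemma cls_in_graded_iff:
  assumes "g \<in> carrier klein_four"
  shows "cls I p \<in> graded g \<longleftrightarrow>
    (\<forall>h\<in>carrier klein_four. klein_act h p - scale (klein_char g h) p \<in> I)"
  using assms
  by (simp add: graded_part_def carrier_quot inv_klein_four klein_act_image_cls smult_quot
      cls_eq_iff rangeI)

text \<open>Averaging the congruences for degree \<open>g'\<close> against the character of
  \<open>g\<close> leaves \<open>p\<close> or 0 modulo \<open>I\<close>, by orthogonality.\<close>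

lemma klein_proj_graded:
  assumes "g \<in> carrier klein_four" "g' \<in> carrier klein_four" "cls I p \<in> graded g'"
  shows "klein_proj g p - (if g = g' then p else 0) \<in> I"
proof -
  have "(if g = g' then p else 0) =
      scale (\<Sum>h\<in>carrier klein_four. klein_char g h / 4 * klein_char g' h) p"
    using assms by (simp only: klein_char_orthogonal) (simp add: scale_one scale_zero_left)
  also have "\<dots> = (\<Sum>h\<in>carrier klein_four. scale (klein_char g h / 4) (scale (klein_char g' h) p))"
    by (simp only: scale_sum_left scale_scale)
  finally have "klein_proj g p - (if g = g' then p else 0) =
      (\<Sum>h\<in>carrier klein_four. scale (klein_char g h / 4)
        (klein_act h p - scale (klein_char g' h) p))"
    by (simp only: klein_proj_def scale_diff_right sum_subtractf)
  also have "\<dots> \<in> I"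
    using assms by (intro sum_in scale_in) (simp add: cls_in_graded_iff)
  finally show ?thesis .
qed

text \<open>Existence comes from \<open>sum_klein_proj\<close>. For uniqueness, lift any
  decomposition to representatives and apply \<open>klein_proj g\<close>: modulo \<open>I\<close>
  only the component of degree \<open>g\<close> survives.\<close>

lemma components_cls:
  "components klein_four klein_char (\<lambda>g X. klein_act g ` X) quot (cls I p) =
    (\<lambda>g\<in>carrier klein_four. cls I (klein_proj g p))"
  unfolding components_def
proof (rule the_equality)
  show "(\<lambda>g\<in>carrier klein_four. cls I (klein_proj g p)) \<in> (\<Pi>\<^sub>E g\<in>carrier klein_four. graded g) \<and>
      cls I p = finsum quot (\<lambda>g\<in>carrier klein_four. cls I (klein_proj g p)) (carrier klein_four)"
    by (simp add: finsum_quot[where y = "\<lambda>g. klein_proj g p"] finite_klein_four sum_klein_proj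
        cls_in_graded_iff klein_act_proj zero_in)
next
  fix f
  assume f: "f \<in> (\<Pi>\<^sub>E g\<in>carrier klein_four. graded g) \<and>
    cls I p = finsum quot f (carrier klein_four)"
  then have "\<forall>g\<in>carrier klein_four. \<exists>y. f g = cls I y"
    by (fastforce simp: graded_part_def carrier_quot)
  then obtain y where y: "\<And>g. g \<in> carrier klein_four \<Longrightarrow> f g = cls I (y g)"
    by metis
  then have "cls I p = cls I (sum y (carrier klein_four))"
    using f by (simp add: finsum_quot[where y = y] finite_klein_four)
  then have p: "p - sum y (carrier klein_four) \<in> I"
    by (simp add: cls_eq_iff)
  have "f g = cls I (klein_proj g p)" if g: "g \<in> carrier klein_four" for g
  proof -
    \<comment> \<open>Writing \<open>y g\<close> as a sum with one nonzero term puts each summand in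
      the form of \<open>klein_proj_graded\<close>.\<close>
    have "klein_proj g (sum y (carrier klein_four)) - y g =
        (\<Sum>g'\<in>carrier klein_four. klein_proj g (y g') - (if g = g' then y g' else 0))"
      using g by (simp add: klein_proj_sum sum_subtractf finite_klein_four)
    also have "\<dots> \<in> I"
      using f g y by (intro sum_in klein_proj_graded) (auto simp: PiE_iff)
    finally have "klein_proj g (p - sum y (carrier klein_four)) +
        (klein_proj g (sum y (carrier klein_four)) - y g) \<in> I"
      using klein_proj_in[OF p] by (rule add_in[rotated])
    then have "cls I (klein_proj g p) = cls I (y g)"
      by (simp add: cls_eq_iff klein_proj_diff)
    then show ?thesis
      using y[OF g] by simp
  qed
  then show "f = (\<lambda>g\<in>carrier klein_four. cls I (klein_proj g p))"
    using f by (intro extensionalityI[of f "carrier klein_four"]) (simp_all add: PiE_iff)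
qed

text \<open>Both sums defining the twisted product are evaluated on the representatives
  \<open>klein_proj\<close>, where \<open>sum_klein_cocycle_proj\<close> identifies the
  result.\<close>

lemma mult_klein_twist: "cls I p \<otimes>\<^bsub>klein_twist quot\<^esub> cls I q = cls I (star p q)"
proof -
  have "finsum quot (\<lambda>h. klein_cocycle g h \<odot>\<^bsub>quot\<^esub>
        (cls I (klein_proj g p) \<otimes>\<^bsub>quot\<^esub> (\<lambda>h\<in>carrier klein_four. cls I (klein_proj h q)) h))
        (carrier klein_four) =
      cls I (\<Sum>h\<in>carrier klein_four. scale (klein_cocycle g h) (klein_proj g p * klein_proj h q))"
    for g
    by (intro finsum_quot finite_klein_four) (simp add: mult_quot smult_quot)
  then show ?thesis
    unfolding klein_twist_def cocycle_twist_def
    by (simp add: components_cls sum_klein_cocycle_proj[symmetric])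
       (intro finsum_quot finite_klein_four, simp add: mult_quot smult_quot)
qed

lemma klein_twist_simps:
  "carrier (klein_twist quot) = range (cls I)" "\<one>\<^bsub>klein_twist quot\<^esub> = cls I 1"
  "cls I p \<oplus>\<^bsub>klein_twist quot\<^esub> cls I q = cls I (p + q)"
  "c \<odot>\<^bsub>klein_twist quot\<^esub> cls I p = cls I (scale c p)"
  by (simp_all add: klein_twist_def cocycle_twist_def carrier_quot one_quot add_quot smult_quot)

end

section \<open>The induced isomorphism of quotients\<close>

text \<open>The isomorphism takes direct images of cosets under \<open>twist_map\<close>;
  \<open>twist_map_star\<close> makes it multiplicative and the involution property makes it
  bijective.\<close>

lemma klein_twist_quot_iso:
  assumes "klein_ideal I" "klein_ideal J" "twist_map ` I = J"
  shows "klein_twist (quot_algebra free_algebra I) \<cong>\<^sub>a\<^sub>l\<^sub>g quot_algebra free_algebra J"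
proof -
  interpret I: klein_ideal I by fact
  interpret J: klein_ideal J by fact
  have image: "twist_map ` cls I p = cls J (twist_map p)" for p
    using assms(3) by (simp add: image_cls twist_map_add)
  have "inj twist_map"
    by (metis injI twist_map_twist_map)
  then have "inj_on ((`) twist_map) (range (cls I))"
    by (meson inj_image_eq_iff inj_onI)
  moreover have "(`) twist_map ` range (cls I) = range (cls J)"
    unfolding image_image image by (metis surjI twist_map_twist_map image_image)
  moreover have "twist_map ` (X \<otimes>\<^bsub>klein_twist I.quot\<^esub> Y) = twist_map ` X \<otimes>\<^bsub>J.quot\<^esub> twist_map ` Y"
    "twist_map ` (X \<oplus>\<^bsub>klein_twist I.quot\<^esub> Y) = twist_map ` X \<oplus>\<^bsub>J.quot\<^esub> twist_map ` Y"
    if XY: "X \<in> range (cls I)" "Y \<in> range (cls I)" for X Y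
  proof -
    obtain p q where "X = cls I p" "Y = cls I q"
      using XY by blast
    then show "twist_map ` (X \<otimes>\<^bsub>klein_twist I.quot\<^esub> Y) = twist_map ` X \<otimes>\<^bsub>J.quot\<^esub> twist_map ` Y"
      "twist_map ` (X \<oplus>\<^bsub>klein_twist I.quot\<^esub> Y) = twist_map ` X \<oplus>\<^bsub>J.quot\<^esub> twist_map ` Y"
      by (simp_all add: I.klein_twist_simps I.mult_klein_twist J.mult_quot J.add_quot image
          twist_map_star twist_map_add)
  qed
  moreover have "twist_map ` X \<in> range (cls J)" if "X \<in> range (cls I)" for X
    using that image by blast
  ultimately have "(`) twist_map \<in> ring_iso (klein_twist I.quot) J.quot"
    by (intro ring_iso_memI)
       (simp_all add: I.klein_twist_simps(1,2) J.carrier_quot J.one_quot image twist_map_one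
         bij_betw_def)
  then show ?thesis
    unfolding algebra_isomorphic_def
    by (rule rev_bexI)
       (auto simp: I.klein_twist_simps J.smult_quot image twist_map_scale)
qed

section \<open>Presentations by homogeneous relations\<close>

definition klein_homogeneous :: "'k::field free3 \<Rightarrow> bool"
  where "klein_homogeneous r \<longleftrightarrow> swap r \<in> {r, - r} \<and> neg r \<in> {r, - r}"

lemma klein_ideal_Idl:
  assumes "\<And>r. r \<in> R \<Longrightarrow> klein_homogeneous r"
  shows "klein_ideal (Idl\<^bsub>free_algebra\<^esub> R)"
proof -
  interpret free_ideal "Idl\<^bsub>free_algebra\<^esub> R" by (rule free_ideal_Idl)
  have "swap ` R \<subseteq> Idl\<^bsub>free_algebra\<^esub> R" "neg ` R \<subseteq> Idl\<^bsub>free_algebra\<^esub> R"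
    using assms subset_Idl[of R] uminus_in unfolding klein_homogeneous_def by fastforce+
  then have "swap ` (Idl\<^bsub>free_algebra\<^esub> R) \<subseteq> Idl\<^bsub>free_algebra\<^esub> R"
    "neg ` (Idl\<^bsub>free_algebra\<^esub> R) \<subseteq> Idl\<^bsub>free_algebra\<^esub> R"
    by (intro Idl_image_subset free_ideal_Idl;
        simp add: subst_add subst_mult mult_left_in mult_right_in)+
  then show ?thesis
    by unfold_locales auto
qed

text \<open>\<open>twist_map\<close> sends products to \<open>star\<close> products. Homogeneity of
  \<open>S\<close> makes the target ideal stable under the action and thereby closed under
  \<open>star\<close> from both sides.\<close>

lemma twist_map_Idl_subset:
  assumes "\<And>s. s \<in> S \<Longrightarrow> klein_homogeneous s" "\<And>r. r \<in> R \<Longrightarrow> \<exists>s\<in>S. twist_map r \<in> {s, - s}"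
  shows "twist_map ` (Idl\<^bsub>free_algebra\<^esub> R) \<subseteq> Idl\<^bsub>free_algebra\<^esub> S"
proof -
  interpret klein_ideal "Idl\<^bsub>free_algebra\<^esub> S" using assms(1) by (rule klein_ideal_Idl)
  show ?thesis
  proof (rule Idl_image_subset)
    show "twist_map ` R \<subseteq> Idl\<^bsub>free_algebra\<^esub> S"
      using assms(2) subset_Idl[of S] uminus_in by fastforce
  qed (simp_all add: free_ideal_Idl twist_map_add twist_map_mult star_left_in star_right_in)
qed

text \<open>The sign is left free because it does not change the ideal generated.\<close>

definition twisted_relation :: "'k::field_char_0 free3 \<Rightarrow> 'k free3 \<Rightarrow> bool"
  where "twisted_relation r s \<longleftrightarrow> klein_homogeneous r \<and> twist_map r \<in> {s, - s}"

lemma klein_homogeneous_twist_map: "klein_homogeneous r \<Longrightarrow> klein_homogeneous (twist_map r)"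
  unfolding klein_homogeneous_def twist_map_swap[symmetric] twist_map_neg[symmetric]
  by (elim conjE insertE emptyE; simp only: twist_map_uminus; simp)

lemma klein_homogeneous_uminus: "klein_homogeneous r \<Longrightarrow> klein_homogeneous (- r)"
  unfolding klein_homogeneous_def subst_uminus
  by (elim conjE insertE emptyE; simp only:; simp)

text \<open>\<open>twist_map\<close> is an involution commuting with the action. One check per pair
  of relations therefore gives both inclusions of ideals.\<close>

lemma twisted_relation_sym:
  assumes "twisted_relation r s"
  shows "twisted_relation s r"
proof -
  have r: "klein_homogeneous r" and "s = twist_map r \<or> s = - twist_map r"
    using assms by (auto simp: twisted_relation_def)
  from this(2) show ?thesis
  proof (elim disjE)
    assume "s = twist_map r"
    then show ?thesis
      using r by (simp add: twisted_relation_def klein_homogeneous_twist_map twist_map_twist_map)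
  next
    assume "s = - twist_map r"
    then show ?thesis
      using r by (simp add: twisted_relation_def klein_homogeneous_twist_map
          klein_homogeneous_uminus twist_map_uminus twist_map_twist_map)
  qed
qed

text \<open>Matches two presentations relation by relation, in the order in which they are
  written.\<close>

lemma rel_set_insert: "P a b \<Longrightarrow> rel_set P A B \<Longrightarrow> rel_set P (insert a A) (insert b B)"
  by (auto simp: rel_set_def)

lemma rel_set_empty: "rel_set P {} {}"
  by (simp add: rel_set_def)

lemma klein_twist_presented:
  assumes "rel_set twisted_relation R S"
  shows "klein_twist (presented R) \<cong>\<^sub>a\<^sub>l\<^sub>g presented S"
  unfolding presented_def
proof (rule klein_twist_quot_iso)
  have R: "\<And>r. r \<in> R \<Longrightarrow> klein_homogeneous r" "\<And>r. r \<in> R \<Longrightarrow> \<exists>s\<in>S. twist_map r \<in> {s, - s}"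
    using assms by (auto simp: rel_set_def twisted_relation_def)
  have S: "\<And>s. s \<in> S \<Longrightarrow> klein_homogeneous s" "\<And>s. s \<in> S \<Longrightarrow> \<exists>r\<in>R. twist_map s \<in> {r, - r}"
    using assms unfolding rel_set_def by (metis twisted_relation_sym twisted_relation_def)+
  show "klein_ideal (Idl\<^bsub>free_algebra\<^esub> R)" "klein_ideal (Idl\<^bsub>free_algebra\<^esub> S)"
    using R(1) S(1) by (simp_all add: klein_ideal_Idl)
  show "twist_map ` (Idl\<^bsub>free_algebra\<^esub> R) = Idl\<^bsub>free_algebra\<^esub> S"
  proof
    show "twist_map ` (Idl\<^bsub>free_algebra\<^esub> R) \<subseteq> Idl\<^bsub>free_algebra\<^esub> S"
      using S(1) R(2) by (rule twist_map_Idl_subset)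
    have "twist_map ` (Idl\<^bsub>free_algebra\<^esub> S) \<subseteq> Idl\<^bsub>free_algebra\<^esub> R"
      using R(1) S(2) by (rule twist_map_Idl_subset)
    then show "Idl\<^bsub>free_algebra\<^esub> S \<subseteq> twist_map ` (Idl\<^bsub>free_algebra\<^esub> R)"
      by (metis image_eqI image_subset_iff subsetI twist_map_twist_map)
  qed
qed

section \<open>The defining relations\<close>

lemma swap_w: "swap w1 = w1" "swap w2 = - w2" "swap w3 = w3"
  and neg_w: "neg w1 = w1" "neg w2 = w2" "neg w3 = - w3"
  by (simp_all add: w1_def w2_def w3_def subst_simps)

lemma twist_map_w: "twist_map w1 = w1" "twist_map w2 = w2" "twist_map w3 = w3"
  by (simp_all add: w1_def w2_def w3_def twist_map_add twist_map_diff twist_map_gen)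

text \<open>Produces the signs on right-nested monomials: only a leading \<open>w3\<close> is odd,
  and its \<open>swap\<close> negates every later \<open>w2\<close>.\<close>

lemma twist_map_w_mult:
  "twist_map (w1 * p) = w1 * twist_map p" "twist_map (w2 * p) = w2 * twist_map p"
  "twist_map (w3 * p) = w3 * swap (twist_map p)"
  by (simp_all add: twist_map_mult twist_map_w star_def even3_eq odd3_eq_0 odd3_eq even3_eq_0 neg_w)

lemmas relation_simps = twisted_relation_def klein_homogeneous_def comm_def acomm_def power2_eq_square
  subst_add subst_uminus subst_scale subst_mult swap_w neg_w
  twist_map_add twist_map_uminus twist_map_scale twist_map_w_mult twist_map_w
  scale_minus_left scale_minus_right diff_conv_add_uminus minus_add_distrib minus_minus
  mult_minus_left mult_minus_right mult.assoc distrib_left distrib_right add.assoc add.commute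
  add.left_commute insert_iff simp_thms

text \<open>In the fourth relation the monomials starting with \<open>w3\<close> change sign and
  those ending with it do not, so the outer commutator becomes an anticommutator up to sign. The
  other three relations are fixed.\<close>

lemma klein_twist_alg_A: "klein_twist (alg_A :: ('k::field_char_0, _) module) \<cong>\<^sub>a\<^sub>l\<^sub>g alg_D"
  unfolding alg_A_def alg_D_def
  by (intro klein_twist_presented rel_set_insert rel_set_empty; simp only: relation_simps)

lemma klein_twist_alg_B: "klein_twist (alg_B :: ('k::field_char_0, _) module) \<cong>\<^sub>a\<^sub>l\<^sub>g alg_C"
  unfolding alg_B_def alg_C_def
  by (intro klein_twist_presented rel_set_insert rel_set_empty; simp only: relation_simps)

text \<open>In the fourth relation exactly the two terms without \<gamma> change sign, which amounts
  to negating \<gamma> up to an overall sign.\<close>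

lemma klein_twist_alg_E:
  "klein_twist (alg_E \<gamma>) \<cong>\<^sub>a\<^sub>l\<^sub>g alg_E (- \<gamma> :: 'k::field_char_0)"
  unfolding alg_E_def
  by (intro klein_twist_presented rel_set_insert rel_set_empty; simp only: relation_simps)

lemma klein_twist_alg_G:
  fixes \<iota> :: "'k::field_char_0"
  assumes "\<iota>\<^sup>2 = - 1" "\<gamma> \<in> {(1 + \<iota>) / 2, (1 - \<iota>) / 2}"
  shows "klein_twist (alg_G \<iota> \<gamma>) \<cong>\<^sub>a\<^sub>l\<^sub>g alg_G \<iota> (1 / (2 * \<gamma>))"
proof -
  define c where "c \<gamma> = (if \<gamma> = (1 + \<iota>) / 2 then \<iota> else - \<iota>)" for \<gamma>
  \<comment> \<open>Were the two parameters equal, the conditional in \<open>c\<close> would return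
    the same root for both.\<close>
  have "(1 - \<iota>) / 2 \<noteq> (1 + \<iota>) / 2"
    using assms(1) by (auto simp: field_simps)
  then have "c (1 / (2 * \<gamma>)) = - c \<gamma>"
    using assms(2)
    by (elim insertE emptyE; simp only: conj_gamma[OF assms(1)])
       (simp_all only: c_def if_True if_False minus_minus simp_thms)
  then show ?thesis
    unfolding alg_G_def Let_def c_def[symmetric]
    by (simp only:) (intro klein_twist_presented rel_set_insert rel_set_empty; simp only: relation_simps)
qed

theorem theorem1p1p20:
  fixes \<iota> :: "'k::{alg_closed_field, field_char_0}"
  assumes "\<iota>^2 = - 1"
  shows "klein_twist (alg_A :: ('k, 'k free3 set) module) \<cong>\<^sub>a\<^sub>l\<^sub>g (alg_D :: ('k, 'k free3 set) module)
    \<and> klein_twist (alg_B :: ('k, 'k free3 set) module) \<cong>\<^sub>a\<^sub>l\<^sub>g (alg_C :: ('k, 'k free3 set) module)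
    \<and> (\<forall>\<gamma> \<in> {\<iota>, - \<iota>}. klein_twist (alg_E \<gamma>) \<cong>\<^sub>a\<^sub>l\<^sub>g alg_E (- \<gamma>))
    \<and> (\<forall>\<gamma> \<in> {(1 + \<iota>) / 2, (1 - \<iota>) / 2}. klein_twist (alg_G \<iota> \<gamma>) \<cong>\<^sub>a\<^sub>l\<^sub>g alg_G \<iota> (1 / (2 * \<gamma>)))"
  using klein_twist_alg_A klein_twist_alg_B klein_twist_alg_E klein_twist_alg_G[OF assms] by blast

end
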